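(* Let $\Lambda$ be an $n$-dimensional lattice in $\mathbb{E}^n$ and let $m=p_1^{\alpha_1}p_2^{\alpha_2}\cdots p_\ell^{\alpha_\ell}$, where $p_1,\ldots,p_\ell$ are pairwise distinct prime numbers and $\alpha_1,\ldots,\alpha_\ell$ are positive integers. Let $f_n^*(m)$ denote the number of equivalence classes of sublattices of $\Lambda$ of index $m$. Then $$f_n^*(m)=\prod_{i=1}^{\ell}p_n(\alpha_i).$$
   Context: $\mathbb{E}^n$ is the $n$-dimensional Euclidean space. An $n$-dimensional lattice is a set $\Lambda=\{\sum_{i=1}^n z_i\mathbf{a}_i : z_i\in\mathbb{Z}\}$, where $\mathbf{a}_1,\ldots,\mathbf{a}_n$ are linearly independent vectors in $\mathbb{E}^n$; $\{\mathbf{a}_1,\ldots,\mathbf{a}_n\}$ is called a basis of $\Lambda$. A sublattice of $\Lambda$ is a subset $\Lambda^*\subseteq\Lambda$ which is itself an $n$-dimensional lattice. If $\{\mathbf{b}_1,\ldots,\mathbf{b}_n\}$ is a basis of $\Lambda^*$ and $\mathbf{b}_i=\sum_{j} d_{ij}\mathbf{a}_j$ with $d_{ij}\in\mathbb{Z}$, the index of $\Lambda^*$ in $\Lambda$ is $|\det(d_{ij})|$. Two sublattices $\Lambda^*$ and $\Lambda^\bullet$ of $\Lambda$ are equivalent if there is a linear transformation $\sigma$ of $\mathbb{E}^n$ with $\sigma(\Lambda)=\Lambda$ and $\sigma(\Lambda^* )=\Lambda^\bullet$. For a positive integer $k$, $p_n(k)$ denotes the number of integer solutions $(x_1,\ldots,x_n)$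 of $x_1+x_2+\cdots+x_n=k$ with $x_1\ge x_2\ge\cdots\ge x_n\ge 0$. *)

theory Defs
  imports "HOL-Analysis.Analysis" "HOL-Computational_Algebra.Primes"
begin

definition lattice_basis :: "('n::finite \<Rightarrow> real ^ 'n) \<Rightarrow> (real ^ 'n) set \<Rightarrow> bool" where
  "lattice_basis a L \<longleftrightarrow>
     inj a \<and> independent (range a) \<and>
     L = {\<Sum>i\<in>UNIV. of_int (z i) *\<^sub>R a i | z :: 'n \<Rightarrow> int. True}"

definition is_lattice :: "(real ^ 'n::finite) set \<Rightarrow> bool" where
  "is_lattice L \<longleftrightarrow> (\<exists>a. lattice_basis a L)"

definition is_sublattice :: "(real ^ 'n::finite) set \<Rightarrow> (real ^ 'n) set \<Rightarrow> bool" where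
  "is_sublattice L' L \<longleftrightarrow> L' \<subseteq> L \<and> is_lattice L'"

text \<open>
  The index does not depend on the chosen bases, so the description below is uniquely satisfied
  whenever \<open>L'\<close> is a sublattice of the lattice \<open>L\<close>; see \<open>lattice_index_eq\<close>.
\<close>

definition lattice_index :: "(real ^ 'n::finite) set \<Rightarrow> (real ^ 'n) set \<Rightarrow> nat" where
  "lattice_index L' L =
     (THE k. \<exists>a b. \<exists>D :: int ^ 'n ^ 'n.
        lattice_basis a L \<and> lattice_basis b L' \<and>
        (\<forall>i. b i = (\<Sum>j\<in>UNIV. of_int (D $ i $ j) *\<^sub>R a j)) \<and>
        int k = \<bar>det D\<bar>)"

definition sublattices_of_index :: "(real ^ 'n::finite) set \<Rightarrow> nat \<Rightarrow> (real ^ 'n) set set" where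
  "sublattices_of_index L m = {L'. is_sublattice L' L \<and> lattice_index L' L = m}"

definition equivalent_sublattices ::
  "(real ^ 'n::finite) set \<Rightarrow> (real ^ 'n) set \<Rightarrow> (real ^ 'n) set \<Rightarrow> bool" where
  "equivalent_sublattices L L1 L2 \<longleftrightarrow>
     (\<exists>\<sigma> :: real ^ 'n \<Rightarrow> real ^ 'n. linear \<sigma> \<and> \<sigma> ` L = L \<and> \<sigma> ` L1 = L2)"

definition num_sublattice_classes :: "(real ^ 'n::finite) set \<Rightarrow> nat \<Rightarrow> nat" where
  "num_sublattice_classes L m =
     card (sublattices_of_index L m //
       {(L1, L2). L1 \<in> sublattices_of_index L m \<and> L2 \<in> sublattices_of_index L m \<and>
                  equivalent_sublattices L L1 L2})"

definition num_partitions :: "nat \<Rightarrow> nat \<Rightarrow> nat" where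
  "num_partitions n k =
     card {xs :: nat list. length xs = n \<and> sorted_wrt (\<ge>) xs \<and> sum_list xs = k}"

lemma lattice_basis_coords_unique:
  fixes a :: "'n::finite \<Rightarrow> real ^ 'n"
  assumes "inj a" "independent (range a)"
    and "(\<Sum>j\<in>UNIV. c j *\<^sub>R a j) = (\<Sum>j\<in>UNIV. d j *\<^sub>R a j)"
  shows "c j = d j"
proof -
  have "(\<Sum>v\<in>range a. (c (inv a v) - d (inv a v)) *\<^sub>R v) = (\<Sum>j\<in>UNIV. (c j - d j) *\<^sub>R a j)"
    using assms(1) by (subst sum.reindex) auto
  also have "\<dots> = 0"
    using assms(3) by (simp add: scaleR_diff_left sum_subtractf)
  finally have "c (inv a v) - d (inv a v) = 0" if "v \<in> range a" for v
    using independentD[OF assms(2) finite_imageI[OF finite] subset_refl,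
        of "\<lambda>v. c (inv a v) - d (inv a v)", OF _ that] by simp
  from this[of "a j"] show ?thesis
    using assms(1) by simp
qed

lemma int_comb_mult:
  fixes a :: "'n::finite \<Rightarrow> real ^ 'n" and P Q :: "int ^ 'n ^ 'n"
  shows "(\<Sum>j\<in>UNIV. of_int (P $ i $ j) *\<^sub>R (\<Sum>k\<in>UNIV. of_int (Q $ j $ k) *\<^sub>R a k)) =
         (\<Sum>k\<in>UNIV. of_int ((P ** Q) $ i $ k) *\<^sub>R a k)"
  by (simp add: matrix_matrix_mult_def scaleR_sum_right scaleR_sum_left) (rule sum.swap)

lemma int_comb_unique:
  fixes a :: "'n::finite \<Rightarrow> real ^ 'n" and P Q :: "int ^ 'n ^ 'n"
  assumes "lattice_basis a L"
    and "\<And>i. (\<Sum>j\<in>UNIV. of_int (P $ i $ j) *\<^sub>R a j) = (\<Sum>j\<in>UNIV. of_int (Q $ i $ j) *\<^sub>R a j)"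
  shows "P = Q"
proof -
  have "real_of_int (P $ i $ j) = of_int (Q $ i $ j)" for i j
    using assms lattice_basis_coords_unique[of a "\<lambda>j. of_int (P $ i $ j)" "\<lambda>j. of_int (Q $ i $ j)" j]
    by (auto simp: lattice_basis_def)
  then show ?thesis
    by (simp add: vec_eq_iff)
qed

lemma lattice_basis_mem:
  assumes "lattice_basis b L"
  shows "b i \<in> L"
proof -
  have "b i = (\<Sum>j\<in>UNIV. of_int (if j = i then 1 else 0) *\<^sub>R b j)"
    by (simp add: if_distrib[of real_of_int] if_distrib[of "\<lambda>c. c *\<^sub>R _"] cong: if_cong)
  then show ?thesis
    using assms unfolding lattice_basis_def
    by (auto intro!: exI[of _ "\<lambda>j. if j = i then 1 else 0"])
qed

lemma lattice_basis_expand: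
  fixes a b :: "'n::finite \<Rightarrow> real ^ 'n"
  assumes "lattice_basis a L" "lattice_basis b L'" "L' \<subseteq> L"
  obtains D :: "int ^ 'n ^ 'n" where "\<And>i. b i = (\<Sum>j\<in>UNIV. of_int (D $ i $ j) *\<^sub>R a j)"
proof -
  have "\<exists>z :: 'n \<Rightarrow> int. b i = (\<Sum>j\<in>UNIV. of_int (z j) *\<^sub>R a j)" for i
    using lattice_basis_mem[OF assms(2), of i] assms(1,3) unfolding lattice_basis_def by blast
  then obtain z :: "'n \<Rightarrow> 'n \<Rightarrow> int" where z: "\<And>i. b i = (\<Sum>j\<in>UNIV. of_int (z i j) *\<^sub>R a j)"
    by metis
  show thesis
    by (rule that[of "\<chi> i j. z i j"]) (simp add: z)
qed

lemma lattice_basis_change: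
  fixes a b :: "'n::finite \<Rightarrow> real ^ 'n"
  assumes a: "lattice_basis a L" and b: "lattice_basis b L"
  obtains P :: "int ^ 'n ^ 'n"
  where "\<And>i. b i = (\<Sum>j\<in>UNIV. of_int (P $ i $ j) *\<^sub>R a j)" "\<bar>det P\<bar> = 1"
proof -
  obtain P :: "int ^ 'n ^ 'n" where P: "\<And>i. b i = (\<Sum>j\<in>UNIV. of_int (P $ i $ j) *\<^sub>R a j)"
    using lattice_basis_expand[OF a b] by blast
  obtain Q :: "int ^ 'n ^ 'n" where Q: "\<And>i. a i = (\<Sum>j\<in>UNIV. of_int (Q $ i $ j) *\<^sub>R b j)"
    using lattice_basis_expand[OF b a] by blast
  have "(\<Sum>k\<in>UNIV. of_int ((P ** Q) $ i $ k) *\<^sub>R b k) =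
        (\<Sum>k\<in>UNIV. of_int ((mat 1 :: int ^ 'n ^ 'n) $ i $ k) *\<^sub>R b k)" for i
  proof -
    have "(\<Sum>k\<in>UNIV. of_int ((P ** Q) $ i $ k) *\<^sub>R b k) = b i"
      unfolding int_comb_mult[symmetric] Q[symmetric] P[symmetric] ..
    also have "\<dots> = (\<Sum>k\<in>UNIV. of_int ((mat 1 :: int ^ 'n ^ 'n) $ i $ k) *\<^sub>R b k)"
      by (simp add: mat_def if_distrib[of real_of_int] if_distrib[of "\<lambda>c. c *\<^sub>R _"] cong: if_cong)
    finally show ?thesis .
  qed
  then have "P ** Q = mat 1"
    by (rule int_comb_unique[OF b])
  then have "det P * det Q = 1"
    by (metis det_mul det_I)
  then have "\<bar>det P\<bar> = 1"
    by (metis abs_zmult_eq_1 abs_one)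
  with P show thesis
    using that by blast
qed

lemma lattice_index_eq:
  fixes a b :: "'n::finite \<Rightarrow> real ^ 'n" and D :: "int ^ 'n ^ 'n"
  assumes a: "lattice_basis a L" and b: "lattice_basis b L'"
    and D: "\<And>i. b i = (\<Sum>j\<in>UNIV. of_int (D $ i $ j) *\<^sub>R a j)"
  shows "int (lattice_index L' L) = \<bar>det D\<bar>"
proof -
  have unique: "\<bar>det D'\<bar> = \<bar>det D\<bar>"
    if a': "lattice_basis a' L" and b': "lattice_basis b' L'"
      and D': "\<And>i. b' i = (\<Sum>j\<in>UNIV. of_int (D' $ i $ j) *\<^sub>R a' j)"
    for a' b' :: "'n \<Rightarrow> real ^ 'n" and D' :: "int ^ 'n ^ 'n"
  proof -
    obtain P :: "int ^ 'n ^ 'n"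
      where P: "\<And>i. a' i = (\<Sum>j\<in>UNIV. of_int (P $ i $ j) *\<^sub>R a j)" "\<bar>det P\<bar> = 1"
      using lattice_basis_change[OF a a'] by blast
    obtain Q :: "int ^ 'n ^ 'n"
      where Q: "\<And>i. b' i = (\<Sum>j\<in>UNIV. of_int (Q $ i $ j) *\<^sub>R b j)" "\<bar>det Q\<bar> = 1"
      using lattice_basis_change[OF b b'] by blast
    have "(\<Sum>k\<in>UNIV. of_int ((D' ** P) $ i $ k) *\<^sub>R a k) =
          (\<Sum>k\<in>UNIV. of_int ((Q ** D) $ i $ k) *\<^sub>R a k)" for i
      unfolding int_comb_mult[symmetric] P(1)[symmetric] D[symmetric] D'[symmetric] Q(1)[symmetric] ..
    then have "D' ** P = Q ** D"
      by (rule int_comb_unique[OF a])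
    then have "det D' * det P = det Q * det D"
      by (metis det_mul)
    then show ?thesis
      using P(2) Q(2) by (metis abs_mult mult.left_neutral mult.right_neutral)
  qed
  have "lattice_index L' L = nat \<bar>det D\<bar>"
    unfolding lattice_index_def
  proof (rule the_equality)
    show "\<exists>a b. \<exists>D' :: int ^ 'n ^ 'n. lattice_basis a L \<and> lattice_basis b L' \<and>
        (\<forall>i. b i = (\<Sum>j\<in>UNIV. of_int (D' $ i $ j) *\<^sub>R a j)) \<and> int (nat \<bar>det D\<bar>) = \<bar>det D'\<bar>"
      using a b D by (intro exI[of _ a] exI[of _ b] exI[of _ D]) simp
  next
    fix k
    assume "\<exists>a b. \<exists>D' :: int ^ 'n ^ 'n. lattice_basis a L \<and> lattice_basis b L' \<and>
        (\<forall>i. b i = (\<Sum>j\<in>UNIV. of_int (D' $ i $ j) *\<^sub>R a j)) \<and> int k = \<bar>det D'\<bar>"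
    then have "int k = \<bar>det D\<bar>"
      using unique by metis
    then show "k = nat \<bar>det D\<bar>"
      by simp
  qed
  then show ?thesis
    by simp
qed

lemma equivalent_sublattices_refl: "equivalent_sublattices L L1 L1"
  unfolding equivalent_sublattices_def by (rule exI[of _ id]) (simp add: linear_id)

lemma equivalent_sublattices_trans:
  assumes "equivalent_sublattices L L1 L2" "equivalent_sublattices L L2 L3"
  shows "equivalent_sublattices L L1 L3"
proof -
  obtain s t where st: "linear s" "s ` L = L" "s ` L1 = L2" "linear t" "t ` L = L" "t ` L2 = L3"
    using assms unfolding equivalent_sublattices_def by blast
  then have "linear (t \<circ> s)" "(t \<circ> s) ` L = L" "(t \<circ> s) ` L1 = L3"
    unfolding image_comp[symmetric] by (auto intro: linear_compose)
  then show ?thesis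
    unfolding equivalent_sublattices_def by blast
qed

lemma span_lattice:
  fixes L :: "(real ^ 'n::finite) set"
  assumes "is_lattice L"
  shows "span L = UNIV"
proof -
  obtain a where a: "lattice_basis a L"
    using assms unfolding is_lattice_def by blast
  then have "card (range a) = CARD('n)"
    by (simp add: lattice_basis_def card_image)
  then have "UNIV \<subseteq> span (range a)"
    using a by (intro card_ge_dim_independent) (auto simp: lattice_basis_def)
  also have "\<dots> \<subseteq> span L"
    using lattice_basis_mem[OF a] by (intro span_mono) blast
  finally show ?thesis
    by blast
qed

lemma equivalent_sublattices_sym:
  assumes "is_lattice L" "equivalent_sublattices L L1 L2"
  shows "equivalent_sublattices L L2 L1"
proof -
  obtain s where s: "linear s" "s ` L = L" "s ` L1 = L2"
    using assms(2) unfolding equivalent_sublattices_def by blast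
  have "range s = UNIV"
    using linear_span_image[OF s(1), of L] s(2) span_lattice[OF assms(1)] by simp
  then obtain t where t: "linear t" "\<And>x. t (s x) = x"
    using linear_surjective_isomorphism[OF s(1)] by blast
  then have "t ` s ` X = X" for X
    by (simp add: image_image)
  with s t(1) show ?thesis
    unfolding equivalent_sublattices_def by metis
qed

lemma equiv_equivalent_sublattices:
  assumes "is_lattice L"
  shows "equiv (sublattices_of_index L m)
    {(L1, L2). L1 \<in> sublattices_of_index L m \<and> L2 \<in> sublattices_of_index L m \<and>
               equivalent_sublattices L L1 L2}"
proof (rule equivI)
  show "trans {(L1, L2). L1 \<in> sublattices_of_index L m \<and> L2 \<in> sublattices_of_index L m \<and>
               equivalent_sublattices L L1 L2}"
    by (rule transI) (auto intro: equivalent_sublattices_trans)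
qed (auto simp: refl_on_def sym_def intro: equivalent_sublattices_refl
       equivalent_sublattices_sym[OF assms])

end

(*
  Over the integers a matrix can be brought by unimodular row and column operations to a diagonal
  matrix whose entries form a divisor chain (Smith normal form). Hence a sublattice of index m has,
  for a suitable basis a of L, a basis d_i a_i with d_i positive, totally ordered by divisibility
  and of product m, and its class depends only on d. Conversely the class determines d, because
  L' + kL has basis gcd(d_i, k) a_i and so index prod_i gcd(d_i, k), for every k; these products
  determine the chain d. Finally a divisor chain of product m is given by its p-adic valuations,
  which form, for each prime power p^e exactly dividing m, a partition of e into at most n parts.
*)

theory Submission
  imports Defs
begin

section \<open>Smith normal form\<close>

text \<open>\<open>invertible\<close> refers to integer matrices, so \<open>U\<close> and
  \<open>V\<close> are unimodular. For a matrix of coordinates of one basis in another,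
  \<open>U\<close> changes the basis of the sublattice and \<open>V\<close> that of the ambient
  lattice.\<close>

definition unimod_equiv :: "int ^ 'n::finite ^ 'n \<Rightarrow> int ^ 'n ^ 'n \<Rightarrow> bool" where
  "unimod_equiv D E \<longleftrightarrow> (\<exists>U V. invertible U \<and> invertible V \<and> E = U ** D ** V)"

lemma invertible_mat_1: "invertible (mat 1 :: 'a::semiring_1 ^ 'n::finite ^ 'n)"
  unfolding invertible_def by (rule exI[of _ "mat 1"]) simp

lemma invertible_transpose:
  fixes A :: "'a::comm_semiring_1 ^ 'n::finite ^ 'n"
  assumes "invertible A"
  shows "invertible (transpose A)"
  using assms unfolding invertible_def by (metis matrix_transpose_mul transpose_mat)

lemma unimod_equiv_refl: "unimod_equiv D D"
  unfolding unimod_equiv_def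
  by (rule exI[of _ "mat 1"], rule exI[of _ "mat 1"]) (simp add: invertible_mat_1)

lemma unimod_equiv_trans:
  assumes "unimod_equiv A B" "unimod_equiv B C"
  shows "unimod_equiv A C"
proof -
  obtain U V U' V' where "invertible U" "invertible V" "B = U ** A ** V"
    "invertible U'" "invertible V'" "C = U' ** B ** V'"
    using assms unfolding unimod_equiv_def by blast
  then have "invertible (U' ** U)" "invertible (V ** V')" "C = U' ** U ** A ** (V ** V')"
    by (simp_all add: invertible_mult matrix_mul_assoc)
  then show ?thesis
    unfolding unimod_equiv_def by blast
qed

lemma unimod_equiv_transpose:
  assumes "unimod_equiv A B"
  shows "unimod_equiv (transpose A) (transpose B)"
proof -
  obtain U V where "invertible U" "invertible V" "B = U ** A ** V"
    using assms unfolding unimod_equiv_def by blast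
  then have "invertible (transpose U)" "invertible (transpose V)"
    "transpose B = transpose V ** transpose A ** transpose U"
    by (simp_all add: invertible_transpose matrix_transpose_mul matrix_mul_assoc)
  then show ?thesis
    unfolding unimod_equiv_def by blast
qed

section \<open>Row operations with one source row, used for columns through transposition\<close>

definition add_row_multiples :: "'n \<Rightarrow> ('n \<Rightarrow> int) \<Rightarrow> int ^ 'n::finite ^ 'n \<Rightarrow> int ^ 'n ^ 'n" where
  "add_row_multiples s c D = (\<chi> i j. D $ i $ j + c i * D $ s $ j)"

lemma add_row_multiples_nth [simp]:
  "add_row_multiples s c D $ i $ j = D $ i $ j + c i * D $ s $ j"
  by (simp add: add_row_multiples_def)

text \<open>Combining rows commutes with multiplication from the right. Taking the identity for
  \<open>D\<close> shows that the operation is itself a multiplication from the left.\<close>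

lemma add_row_multiples_mult:
  "add_row_multiples s c D ** E = add_row_multiples s c (D ** E)"
  by (simp add: vec_eq_iff matrix_matrix_mult_def distrib_right sum.distrib sum_distrib_left
      mult.assoc)

text \<open>Since \<open>c s = 0\<close>, the source row is unchanged, so the operation with
  coefficients \<open>- c i\<close> undoes this one.\<close>

lemma unimod_equiv_add_row_multiples:
  assumes "c s = 0"
  shows "unimod_equiv D (add_row_multiples s c D)"
proof -
  have inv: "add_row_multiples s c' (mat 1) ** add_row_multiples s (\<lambda>i. - c' i) (mat 1) = mat 1"
    if "c' s = 0" for c'
    using that by (simp add: add_row_multiples_mult vec_eq_iff)
  have "invertible (add_row_multiples s c (mat 1))"
    unfolding invertible_def using inv[of c] inv[of "\<lambda>i. - c i"] assms by auto
  moreover have "add_row_multiples s c D = add_row_multiples s c (mat 1) ** D ** mat 1"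
    by (simp add: add_row_multiples_mult)
  ultimately show ?thesis
    unfolding unimod_equiv_def using invertible_mat_1 by blast
qed

text \<open>The map \<open>r\<close> ranks the indices, whose type carries no order. An index of
  rank below \<open>k\<close> is finished. Its diagonal entry must divide the whole block from its
  rank on, not only the diagonal there, because this form survives later row and column
  operations.\<close>

definition smith_upto :: "('n \<Rightarrow> nat) \<Rightarrow> nat \<Rightarrow> int ^ 'n::finite ^ 'n \<Rightarrow> bool" where
  "smith_upto r k D \<longleftrightarrow> (\<forall>i. r i < k \<longrightarrow>
     (\<forall>j. j \<noteq> i \<longrightarrow> D $ i $ j = 0 \<and> D $ j $ i = 0) \<and>
     (\<forall>j l. r i \<le> r j \<longrightarrow> r i \<le> r l \<longrightarrow> D $ i $ i dvd D $ j $ l))"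

lemma smith_upto_transpose: "smith_upto r k D \<Longrightarrow> smith_upto r k (transpose D)"
  by (auto simp: smith_upto_def transpose_def)

text \<open>Only rows of rank at least \<open>k\<close> change, and the source row is zero in every
  finished column. An entry that a finished diagonal entry has to divide becomes a sum of two
  multiples of it.\<close>

lemma smith_upto_add_row_multiples:
  assumes D: "smith_upto r k D" and s: "k \<le> r s" and c: "\<And>i. r i < k \<Longrightarrow> c i = 0"
  shows "smith_upto r k (add_row_multiples s c D)"
  unfolding smith_upto_def
proof (intro allI impI conjI)
  fix i j l assume i: "r i < k"
  then have "s \<noteq> i"
    using s by auto
  show "add_row_multiples s c D $ i $ j = 0" if "j \<noteq> i"
    using D i c that by (simp add: smith_upto_def)
  show "add_row_multiples s c D $ j $ i = 0" if "j \<noteq> i"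
    using D i that \<open>s \<noteq> i\<close> by (simp add: smith_upto_def)
  show "add_row_multiples s c D $ i $ i dvd add_row_multiples s c D $ j $ l"
    if "r i \<le> r j" "r i \<le> r l"
    using D i that c s by (simp add: smith_upto_def)
qed

text \<open>One round of elimination: an entry \<open>g\<close> of the remaining block is brought to
  position \<open>(s, s)\<close>, clears its row and column and divides the rest. Minimality of
  \<open>g\<close> takes the place of the descent in the Euclidean algorithm.\<close>

lemma smith_upto_Suc:
  fixes D :: "int ^ 'n::finite ^ 'n"
  assumes r: "inj r" and s: "r s = k" and D: "smith_upto r k D"
  shows "\<exists>E. unimod_equiv D E \<and> smith_upto r (Suc k) E"
proof (cases "\<forall>i j. k \<le> r i \<longrightarrow> k \<le> r j \<longrightarrow> D $ i $ j = 0")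
  case True
  \<comment> \<open>The remaining block is zero, and 0 divides 0, so nothing has to be
    changed.\<close>
  have "smith_upto r (Suc k) D"
    unfolding smith_upto_def
  proof (intro allI impI)
    fix i assume "r i < Suc k"
    then consider "r i < k" | "i = s"
      using r s by (metis injD less_Suc_eq)
    then show "(\<forall>j. j \<noteq> i \<longrightarrow> D $ i $ j = 0 \<and> D $ j $ i = 0) \<and>
        (\<forall>j l. r i \<le> r j \<longrightarrow> r i \<le> r l \<longrightarrow> D $ i $ i dvd D $ j $ l)"
    proof cases
      case 1
      then show ?thesis using D unfolding smith_upto_def by blast
    next
      case 2
      have "D $ s $ j = 0 \<and> D $ j $ s = 0" if "j \<noteq> s" for j
        using True D s that unfolding smith_upto_def by (metis le_refl not_le)
      then show ?thesis using 2 True s by auto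
    qed
  qed
  then show ?thesis using unimod_equiv_refl by blast
next
  case False
  define R where "R = {E. unimod_equiv D E \<and> smith_upto r k E}"
  have row: "add_row_multiples t c E \<in> R"
    if "E \<in> R" "k \<le> r t" "c t = 0" "\<And>i. r i < k \<Longrightarrow> c i = 0" for E t c
    using that unfolding R_def
    by (auto intro: smith_upto_add_row_multiples unimod_equiv_trans unimod_equiv_add_row_multiples)
  have col: "transpose (add_row_multiples t c (transpose E)) \<in> R"
    if "E \<in> R" "k \<le> r t" "c t = 0" "\<And>i. r i < k \<Longrightarrow> c i = 0" for E t c
  proof -
    have "unimod_equiv (transpose E) (add_row_multiples t c (transpose E))"
      using that by (intro unimod_equiv_add_row_multiples) auto
    from unimod_equiv_transpose[OF this]
    have "unimod_equiv E (transpose (add_row_multiples t c (transpose E)))"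
      by simp
    then show ?thesis
      using that unfolding R_def
      by (auto intro: smith_upto_add_row_multiples smith_upto_transpose unimod_equiv_trans)
  qed
  \<comment> \<open>A nonzero entry of least absolute value among all matrices in \<open>R\<close> divides its row and
    column, so row and column additions suffice to copy it to position \<open>(s, s)\<close>, without swaps.\<close>
  define Q where "Q = (\<lambda>n. \<exists>E i j. E \<in> R \<and> k \<le> r i \<and> k \<le> r j \<and> E $ i $ j \<noteq> 0 \<and> n = nat \<bar>E $ i $ j\<bar>)"
  have "\<exists>n. Q n"
    using False D unimod_equiv_refl[of D] unfolding R_def Q_def by blast
  then have "Q (LEAST n. Q n)"
    by (rule LeastI_ex)
  then obtain E0 i0 j0 where E0: "E0 \<in> R" "k \<le> r i0" "k \<le> r j0" "E0 $ i0 $ j0 \<noteq> 0"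
      "(LEAST n. Q n) = nat \<bar>E0 $ i0 $ j0\<bar>"
    unfolding Q_def by blast
  define g where "g = E0 $ i0 $ j0"
  have g: "g \<noteq> 0"
    using E0 by (simp add: g_def)
  have g_min: "\<bar>g\<bar> \<le> \<bar>E $ i $ j\<bar>" if "E \<in> R" "k \<le> r i" "k \<le> r j" "E $ i $ j \<noteq> 0" for E i j
  proof -
    have "(LEAST n. Q n) \<le> nat \<bar>E $ i $ j\<bar>"
      using that by (intro Least_le) (auto simp: Q_def)
    then show ?thesis
      using E0 by (simp add: g_def)
  qed
  \<comment> \<open>A remainder modulo \<open>g\<close> that occurs as an entry is smaller than
    \<open>g\<close> in absolute value, so it vanishes by minimality.\<close>
  have mod_0: "x mod g = 0" if "E \<in> R" "k \<le> r i" "k \<le> r j" "E $ i $ j = x mod g" for E i j x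
    using g_min[OF that(1-3)] that(4) abs_mod_less[OF g, of x] by fastforce
  have dvd_col: "g dvd E $ i' $ j"
    if E: "E \<in> R" "k \<le> r i" "k \<le> r i'" "k \<le> r j" "E $ i $ j = g" for E i i' j
  proof (cases "i' = i")
    case False
    \<comment> \<open>Subtracting the quotient times row \<open>i\<close> leaves the remainder of
      \<open>E $ i' $ j\<close> modulo \<open>g\<close> in its place.\<close>
    have "add_row_multiples i (\<lambda>t. if t = i' then - (E $ i' $ j div g) else 0) E \<in> R"
      using that False by (intro row) auto
    from mod_0[OF this \<open>k \<le> r i'\<close> \<open>k \<le> r j\<close>, of "E $ i' $ j"] show ?thesis
      using E by (simp add: minus_div_mult_eq_mod mod_eq_0_iff_dvd)
  qed (use E in simp)
  have dvd_row: "g dvd E $ i $ j'"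
    if E: "E \<in> R" "k \<le> r i" "k \<le> r j" "k \<le> r j'" "E $ i $ j = g" for E i j j'
  proof (cases "j' = j")
    case False
    have "transpose (add_row_multiples j (\<lambda>t. if t = j' then - (E $ i $ j' div g) else 0) (transpose E)) \<in> R"
      using that False by (intro col) auto
    from mod_0[OF this \<open>k \<le> r i\<close> \<open>k \<le> r j'\<close>, of "E $ i $ j'"] show ?thesis
      using E by (simp add: transpose_def minus_div_mult_eq_mod mod_eq_0_iff_dvd)
  qed (use E in simp)
  have ks: "k \<le> r s"
    using s by simp
  obtain E1 where E1: "E1 \<in> R" "E1 $ s $ j0 = g"
  proof (cases "s = i0")
    case False
    \<comment> \<open>If the entry at \<open>(s, j0)\<close> is \<open>q * g\<close>, adding
      \<open>1 - q\<close> times row \<open>i0\<close> turns it into \<open>g\<close>.\<close>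
    let ?E = "add_row_multiples i0 (\<lambda>t. if t = s then 1 - E0 $ s $ j0 div g else 0) E0"
    have "?E \<in> R"
      using E0 False ks by (intro row) auto
    moreover have "?E $ s $ j0 = g"
      using dvd_col[OF E0(1,2) ks E0(3)] by (simp add: g_def[symmetric] algebra_simps)
    ultimately show ?thesis using that by blast
  qed (use that[of E0] E0 in \<open>simp add: g_def\<close>)
  obtain E2 where E2: "E2 \<in> R" "E2 $ s $ s = g"
  proof (cases "s = j0")
    case False
    let ?E = "transpose (add_row_multiples j0 (\<lambda>t. if t = s then 1 - E1 $ s $ s div g else 0) (transpose E1))"
    have "?E \<in> R"
      using E0 E1 False ks by (intro col) auto
    moreover have "?E $ s $ s = g"
      using dvd_row[OF E1(1) ks E0(3) ks E1(2)] E1(2) by (simp add: transpose_def algebra_simps)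
    ultimately show ?thesis using that by blast
  qed (use that[of E1] E1 in simp)
  define E3 where "E3 = add_row_multiples s (\<lambda>t. if t = s \<or> r t < k then 0 else - (E2 $ t $ s div g)) E2"
  have E3: "E3 \<in> R"
    unfolding E3_def using E2 ks by (intro row) auto
  have E3_ss: "E3 $ s $ s = g"
    by (simp add: E3_def E2)
  have E3_col: "E3 $ i $ s = 0" if "i \<noteq> s" "k \<le> r i" for i
    using dvd_col[OF E2(1) ks that(2) ks E2(2)] that by (simp add: E3_def E2)
  \<comment> \<open>Column \<open>s\<close> is now the source and does not change, so clearing row
    \<open>s\<close> keeps the zeros just made in column \<open>s\<close>.\<close>
  define E where
    "E = transpose (add_row_multiples s (\<lambda>t. if t = s \<or> r t < k then 0 else - (E3 $ s $ t div g)) (transpose E3))"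
  have E: "E \<in> R"
    unfolding E_def using E3 ks by (intro col) auto
  have E_ss: "E $ s $ s = g"
    by (simp add: E_def transpose_def E3_ss)
  have E_col: "E $ i $ s = 0" if "i \<noteq> s" "k \<le> r i" for i
    using E3_col[OF that] by (simp add: E_def transpose_def)
  have E_row: "E $ s $ j = 0" if "j \<noteq> s" "k \<le> r j" for j
    using dvd_row[OF E3 ks ks that(2) E3_ss] that by (simp add: E_def transpose_def E3_ss)
  have E_dvd: "g dvd E $ i $ j" if "k \<le> r i" "k \<le> r j" for i j
  proof (cases "i = s \<or> j = s")
    case True
    then show ?thesis using E_ss E_col E_row that by (metis dvd_0_right dvd_refl)
  next
    case False
    \<comment> \<open>Adding row \<open>i\<close> to row \<open>s\<close> keeps the entry \<open>g\<close> and moves \<open>E $ i $ j\<close> into its row.\<close>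
    have "add_row_multiples i (\<lambda>t. if t = s then 1 else 0) E \<in> R"
      using E that False ks by (intro row) auto
    from dvd_row[OF this ks ks that(2)] show ?thesis
      using False E_ss E_col that E_row by simp
  qed
  have "smith_upto r (Suc k) E"
    unfolding smith_upto_def
  proof (intro allI impI)
    fix i assume "r i < Suc k"
    then consider "r i < k" | "i = s"
      using r s by (metis injD less_Suc_eq)
    then show "(\<forall>j. j \<noteq> i \<longrightarrow> E $ i $ j = 0 \<and> E $ j $ i = 0) \<and>
        (\<forall>j l. r i \<le> r j \<longrightarrow> r i \<le> r l \<longrightarrow> E $ i $ i dvd E $ j $ l)"
    proof cases
      case 1
      then show ?thesis using E unfolding R_def smith_upto_def by blast
    next
      case 2
      have "E $ s $ j = 0 \<and> E $ j $ s = 0" if "j \<noteq> s" for j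
      proof (cases "r j < k")
        case True
        then show ?thesis using E that[symmetric] unfolding R_def smith_upto_def by blast
      qed (use E_row E_col that in auto)
      then show ?thesis using 2 E_dvd E_ss s by auto
    qed
  qed
  then show ?thesis using E unfolding R_def by blast
qed

text \<open>The elimination is repeated until every rank is finished. The divisor chain on the
  diagonal is the divisibility of blocks, restricted to diagonal entries.\<close>

lemma smith_normal_form:
  fixes D :: "int ^ 'n::finite ^ 'n" and r :: "'n \<Rightarrow> nat"
  assumes r: "bij_betw r UNIV {..<CARD('n)}"
  obtains E where "unimod_equiv D E" "\<And>i j. i \<noteq> j \<Longrightarrow> E $ i $ j = 0"
    "\<And>i j. r i \<le> r j \<Longrightarrow> E $ i $ i dvd E $ j $ j"
proof -
  have "\<exists>E. unimod_equiv D E \<and> smith_upto r k E" if "k \<le> CARD('n)" for k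
    using that
  proof (induction k)
    case 0
    show ?case using unimod_equiv_refl by (auto simp: smith_upto_def)
  next
    case (Suc k)
    then obtain E where E: "unimod_equiv D E" "smith_upto r k E"
      by auto
    have "k \<in> range r"
      using r Suc.prems by (auto simp: bij_betw_def)
    then obtain s where "r s = k"
      by auto
    from smith_upto_Suc[OF _ this E(2)] show ?case
      using r E(1) unimod_equiv_trans by (metis bij_betw_imp_inj_on)
  qed
  then obtain E where E: "unimod_equiv D E" "smith_upto r CARD('n) E"
    by blast
  have "r i < CARD('n)" for i
    using r by (auto simp: bij_betw_def)
  then show thesis
    using E that[of E] unfolding smith_upto_def by blast
qed

section \<open>Sublattices and stacked bases\<close>

definition int_span :: "('n::finite \<Rightarrow> real ^ 'n) \<Rightarrow> (real ^ 'n) set" where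
  "int_span a = {\<Sum>i\<in>UNIV. of_int (z i) *\<^sub>R a i | z :: 'n \<Rightarrow> int. True}"

lemma int_spanI: "x = (\<Sum>i\<in>UNIV. of_int (z i) *\<^sub>R a i) \<Longrightarrow> x \<in> int_span a"
  unfolding int_span_def by blast

lemma int_spanE:
  assumes "x \<in> int_span a"
  obtains z where "x = (\<Sum>i\<in>UNIV. of_int (z i) *\<^sub>R a i)"
  using assms unfolding int_span_def by blast

lemma int_span_subset_span: "int_span a \<subseteq> span (range a)"
proof
  fix x assume "x \<in> int_span a"
  then obtain z where "x = (\<Sum>i\<in>UNIV. of_int (z i) *\<^sub>R a i)"
    by (rule int_spanE)
  then show "x \<in> span (range a)"
    by (simp add: span_sum span_scale span_base)
qed

lemma lattice_basis_int_span: "lattice_basis a L \<Longrightarrow> int_span a = L"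
  by (simp add: lattice_basis_def int_span_def)

lemma lattice_basis_span: "lattice_basis a L \<Longrightarrow> span (range a) = UNIV"
  by (metis int_span_subset_span is_lattice_def lattice_basis_int_span span_lattice
      span_minimal subspace_span top.extremum_uniqueI)

text \<open>A spanning family with as many members as the dimension has no repetitions and is
  independent.\<close>

lemma lattice_basisI:
  fixes a :: "'n::finite \<Rightarrow> real ^ 'n"
  assumes "span (range a) = UNIV" "int_span a = L"
  shows "lattice_basis a L"
proof -
  have "CARD('n) = dim (UNIV :: (real ^ 'n) set)"
    by simp
  also have "\<dots> \<le> card (range a)"
    using assms(1) by (intro span_card_ge_dim) auto
  finally have card: "card (range a) = CARD('n)"
    by (simp add: antisym card_image_le)
  then have "inj a"
    by (simp add: eq_card_imp_inj_on)
  moreover have "independent (range a)"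
    using assms(1) card by (intro card_le_dim_spanning[of _ UNIV]) auto
  ultimately show ?thesis
    using assms(2) by (simp add: lattice_basis_def int_span_def)
qed

text \<open>A lattice spans the whole space, so a family that generates it over the integers spans
  the space too and has the right number of members to be a basis.\<close>

lemma lattice_basis_iff:
  assumes "is_lattice L"
  shows "lattice_basis a L \<longleftrightarrow> int_span a = L"
proof
  assume a: "int_span a = L"
  then have "span (range a) = UNIV"
    by (metis int_span_subset_span span_lattice[OF assms] span_minimal subspace_span
        top.extremum_uniqueI)
  then show "lattice_basis a L"
    using a by (rule lattice_basisI)
qed (rule lattice_basis_int_span)

section \<open>Integer matrices acting on bases\<close>

definition mat_comb :: "int ^ 'n::finite ^ 'n \<Rightarrow> ('n \<Rightarrow> real ^ 'n) \<Rightarrow> 'n \<Rightarrow> real ^ 'n" where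
  "mat_comb W a i = (\<Sum>j\<in>UNIV. of_int (W $ i $ j) *\<^sub>R a j)"

lemma mat_comb_mat_comb: "mat_comb V (mat_comb W a) = mat_comb (V ** W) a"
  by (rule ext) (simp add: mat_comb_def int_comb_mult)

lemma mat_comb_mat_1: "mat_comb (mat 1) a = a"
  by (rule ext) (simp add: mat_comb_def mat_def if_distrib[of real_of_int]
      if_distrib[of "\<lambda>c. c *\<^sub>R _"] cong: if_cong)

lemma int_span_mat_comb_subset: "int_span (mat_comb W a) \<subseteq> int_span a"
proof
  fix x assume "x \<in> int_span (mat_comb W a)"
  then obtain z where "x = (\<Sum>i\<in>UNIV. of_int (z i) *\<^sub>R mat_comb W a i)"
    by (rule int_spanE)
  also have "\<dots> = (\<Sum>j\<in>UNIV. of_int (\<Sum>i\<in>UNIV. z i * W $ i $ j) *\<^sub>R a j)"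
    by (simp add: mat_comb_def scaleR_sum_right scaleR_sum_left) (rule sum.swap)
  finally show "x \<in> int_span a"
    by (rule int_spanI)
qed

lemma lattice_basis_mat_comb:
  assumes "lattice_basis a L" "invertible W"
  shows "lattice_basis (mat_comb W a) L"
proof -
  obtain W' where "W' ** W = mat 1"
    using assms(2) unfolding invertible_def by blast
  then have "int_span (mat_comb W a) = int_span a"
    by (metis antisym int_span_mat_comb_subset mat_comb_mat_comb mat_comb_mat_1)
  then show ?thesis
    using assms(1) lattice_basis_iff lattice_basis_int_span is_lattice_def by metis
qed

section \<open>Sublattices generated by multiples of basis vectors\<close>

definition diag_lattice :: "('n::finite \<Rightarrow> real ^ 'n) \<Rightarrow> ('n \<Rightarrow> nat) \<Rightarrow> (real ^ 'n) set" where
  "diag_lattice a d = int_span (\<lambda>i. real (d i) *\<^sub>R a i)"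

lemma lattice_basis_diag:
  assumes a: "lattice_basis a L" and d: "\<And>i. d i > 0"
  shows "lattice_basis (\<lambda>i. real (d i) *\<^sub>R a i) (diag_lattice a d)"
proof (rule lattice_basisI)
  let ?b = "\<lambda>i. real (d i) *\<^sub>R a i"
  have "a i \<in> span (range ?b)" for i
    using span_scale[OF span_base[of "?b i" "range ?b"], of "1 / real (d i)"] d[of i] by simp
  then have "span (range a) \<subseteq> span (range ?b)"
    by (intro span_minimal) auto
  then show "span (range ?b) = UNIV"
    using lattice_basis_span[OF a] by blast
qed (simp add: diag_lattice_def)

lemma det_of_diagonal:
  fixes d :: "'n::finite \<Rightarrow> int"
  shows "det (\<chi> i j. if i = j then d i else 0) = (\<Prod>i\<in>UNIV. d i)"
  by (subst det_diagonal) auto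

lemma diag_lattice_in_sublattices_of_index:
  assumes a: "lattice_basis a L" and d: "\<And>i. d i > 0"
  shows "diag_lattice a d \<in> sublattices_of_index L (\<Prod>i\<in>UNIV. d i)"
proof -
  let ?D = "\<chi> i j. if i = j then int (d i) else 0"
  have D: "real (d i) *\<^sub>R a i = mat_comb ?D a i" for i
    by (simp add: mat_comb_def if_distrib[of real_of_int] if_distrib[of "\<lambda>c. c *\<^sub>R _"] cong: if_cong)
  then have "(\<lambda>i. real (d i) *\<^sub>R a i) = mat_comb ?D a"
    by (rule ext)
  then have "diag_lattice a d \<subseteq> L"
    using int_span_mat_comb_subset[of ?D a] lattice_basis_int_span[OF a]
    by (simp add: diag_lattice_def)
  moreover have "int (lattice_index (diag_lattice a d) L) = \<bar>det ?D\<bar>"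
    using D by (intro lattice_index_eq[OF a lattice_basis_diag[OF a d]]) (simp add: mat_comb_def)
  then have "int (lattice_index (diag_lattice a d) L) = int (\<Prod>i\<in>UNIV. d i)"
    by (simp only: det_of_diagonal) (simp add: abs_prod)
  then have "lattice_index (diag_lattice a d) L = (\<Prod>i\<in>UNIV. d i)"
    by (simp only: of_nat_eq_iff)
  moreover have "is_lattice (diag_lattice a d)"
    using lattice_basis_diag[of a L d] a d unfolding is_lattice_def by blast
  ultimately show ?thesis
    by (simp add: sublattices_of_index_def is_sublattice_def)
qed

text \<open>The Smith normal form may have negative diagonal entries, while
  \<open>diag_lattice\<close> takes natural factors. Signs are absorbed into the integer
  coefficients.\<close>

lemma int_span_scale_nat_abs:
  "int_span (\<lambda>i. of_int (e i) *\<^sub>R a i) = diag_lattice a (\<lambda>i. nat \<bar>e i\<bar>)"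
proof -
  have "int_span (\<lambda>i. of_int (f i) *\<^sub>R a i) \<subseteq> int_span (\<lambda>i. of_int (g i) *\<^sub>R a i)"
    if fg: "\<And>i. \<bar>f i\<bar> = \<bar>g i\<bar>" for f g :: "'a \<Rightarrow> int"
  proof
    fix x assume "x \<in> int_span (\<lambda>i. of_int (f i) *\<^sub>R a i)"
    then obtain z where x: "x = (\<Sum>i\<in>UNIV. of_int (z i) *\<^sub>R (of_int (f i) *\<^sub>R a i))"
      by (rule int_spanE)
    have "g i = f i \<or> g i = - f i" for i
      using fg[of i] by linarith
    then have "of_int (z i) *\<^sub>R (of_int (f i) *\<^sub>R a i)
        = of_int (if g i = f i then z i else - z i) *\<^sub>R (of_int (g i) *\<^sub>R a i)" for i
      by (smt (verit) minus_mult_minus of_int_minus scaleR_scaleR)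
    then have "x = (\<Sum>i\<in>UNIV. of_int (if g i = f i then z i else - z i) *\<^sub>R (of_int (g i) *\<^sub>R a i))"
      unfolding x by (rule sum.cong[OF refl])
    then show "x \<in> int_span (\<lambda>i. of_int (g i) *\<^sub>R a i)"
      by (rule int_spanI)
  qed
  from this[of e "\<lambda>i. int (nat \<bar>e i\<bar>)"] this[of "\<lambda>i. int (nat \<bar>e i\<bar>)" e] show ?thesis
    by (simp add: diag_lattice_def)
qed

text \<open>If \<open>b\<close> has the coordinate matrix \<open>D\<close> in \<open>a\<close> and
  \<open>E = U ** D ** V\<close> is diagonal, then \<open>U\<close> applied to \<open>b\<close> has
  the coordinate matrix \<open>E\<close> in the basis obtained by applying the inverse of
  \<open>V\<close> to \<open>a\<close>.\<close>

lemma stacked_bases: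
  fixes L :: "(real ^ 'n::finite) set" and r :: "'n \<Rightarrow> nat"
  assumes L: "is_lattice L" and L': "L' \<in> sublattices_of_index L m"
    and r: "bij_betw r UNIV {..<CARD('n)}"
  obtains a d where "lattice_basis a L" "L' = diag_lattice a d"
    "\<And>i j. r i \<le> r j \<Longrightarrow> d i dvd d j" "(\<Prod>i\<in>UNIV. d i) = m"
proof -
  obtain a b where a: "lattice_basis a L" and b: "lattice_basis b L'"
    using L L' by (auto simp: is_lattice_def sublattices_of_index_def is_sublattice_def)
  have "L' \<subseteq> L" "lattice_index L' L = m"
    using L' by (auto simp: sublattices_of_index_def is_sublattice_def)
  then obtain D where "\<And>i. b i = (\<Sum>j\<in>UNIV. of_int (D $ i $ j) *\<^sub>R a j)"
    using lattice_basis_expand[OF a b] by blast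
  then have D: "b = mat_comb D a"
    by (auto simp: mat_comb_def)
  obtain E where E: "unimod_equiv D E" "\<And>i j. i \<noteq> j \<Longrightarrow> E $ i $ j = 0"
    "\<And>i j. r i \<le> r j \<Longrightarrow> E $ i $ i dvd E $ j $ j"
    using smith_normal_form[OF r, of D] by blast
  obtain U V where UV: "invertible U" "invertible V" "E = U ** D ** V"
    using E(1) unfolding unimod_equiv_def by blast
  obtain V' where V': "V ** V' = mat 1" "V' ** V = mat 1"
    using UV(2) unfolding invertible_def by blast
  define a' where "a' = mat_comb V' a"
  have a': "lattice_basis a' L"
    unfolding a'_def using V' by (intro lattice_basis_mat_comb[OF a]) (auto simp: invertible_def)
  have b': "lattice_basis (mat_comb U b) L'"
    by (rule lattice_basis_mat_comb[OF b UV(1)])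
  have Ea': "mat_comb U b = mat_comb E a'"
    using V' by (simp add: a'_def D UV(3) mat_comb_mat_comb flip: matrix_mul_assoc)
  have "mat_comb E a' = (\<lambda>i. of_int (E $ i $ i) *\<^sub>R a' i)"
  proof
    fix i
    have "mat_comb E a' i = (\<Sum>j\<in>UNIV. if j = i then of_int (E $ i $ i) *\<^sub>R a' i else 0)"
      unfolding mat_comb_def using E(2) by (intro sum.cong) auto
    then show "mat_comb E a' i = of_int (E $ i $ i) *\<^sub>R a' i"
      by simp
  qed
  then have L'_eq: "L' = diag_lattice a' (\<lambda>i. nat \<bar>E $ i $ i\<bar>)"
    using lattice_basis_int_span[OF b'] Ea' int_span_scale_nat_abs by metis
  have "int m = \<bar>det E\<bar>"
    unfolding \<open>lattice_index L' L = m\<close>[symmetric]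
    by (rule lattice_index_eq[OF a' b']) (simp add: Ea' mat_comb_def)
  also have "\<dots> = int (\<Prod>i\<in>UNIV. nat \<bar>E $ i $ i\<bar>)"
    using E(2) by (simp add: det_diagonal abs_prod)
  finally have "(\<Prod>i\<in>UNIV. nat \<bar>E $ i $ i\<bar>) = m"
    by (simp only: of_nat_eq_iff)
  then show thesis
    using that[OF a' L'_eq] E(3) by (simp add: nat_abs_dvd_iff)
qed

section \<open>Equivalence of diagonal sublattices and invariance of the divisor chain\<close>

lemma image_int_span:
  assumes "linear \<sigma>"
  shows "\<sigma> ` int_span a = int_span (\<sigma> \<circ> a)"
proof -
  have "int_span (\<sigma> \<circ> a) = {\<sigma> (\<Sum>i\<in>UNIV. of_int (z i) *\<^sub>R a i) | z. True}"
    unfolding int_span_def by (simp add: linear_sum[OF assms] linear_scale[OF assms])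
  then show ?thesis
    unfolding int_span_def by blast
qed

lemma image_diag_lattice: "linear \<sigma> \<Longrightarrow> \<sigma> ` diag_lattice a d = diag_lattice (\<sigma> \<circ> a) d"
  by (simp add: diag_lattice_def image_int_span o_def linear_scale)

text \<open>The linear map sending each \<open>a i\<close> to \<open>b i\<close> maps
  \<open>L\<close> onto itself and carries one sublattice to the other.\<close>

lemma equivalent_diag_lattices:
  assumes a: "lattice_basis a L" and b: "lattice_basis b L"
  shows "equivalent_sublattices L (diag_lattice a d) (diag_lattice b d)"
proof -
  have "inj a" "independent (range a)"
    using a by (auto simp: lattice_basis_def)
  then obtain \<sigma> where \<sigma>: "linear \<sigma>" "\<And>x. x \<in> range a \<Longrightarrow> \<sigma> x = b (inv a x)"
    using linear_independent_extend[of "range a" "\<lambda>x. b (inv a x)"] by blast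
  have "\<sigma> \<circ> a = b"
    using \<sigma>(2) \<open>inj a\<close> by auto
  moreover have "\<sigma> ` L = L"
    using image_int_span[OF \<sigma>(1), of a] \<open>\<sigma> \<circ> a = b\<close> a b lattice_basis_int_span by metis
  ultimately show ?thesis
    using \<sigma>(1) image_diag_lattice[OF \<sigma>(1), of a d] unfolding equivalent_sublattices_def by metis
qed

text \<open>In each coordinate the multiples of \<open>d i\<close> and of \<open>k\<close> together
  generate the multiples of their gcd, by Bezout. The left-hand side depends only on the sublattice
  and the lattice, so it does not see the choice of basis.\<close>

lemma diag_lattice_plus_multiples:
  fixes a :: "'n::finite \<Rightarrow> real ^ 'n"
  shows "{x + real k *\<^sub>R y | x y. x \<in> diag_lattice a d \<and> y \<in> int_span a} =
         diag_lattice a (\<lambda>i. gcd (d i) k)"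
proof (intro equalityI subsetI)
  fix v assume "v \<in> {x + real k *\<^sub>R y | x y. x \<in> diag_lattice a d \<and> y \<in> int_span a}"
  then obtain z w :: "'n \<Rightarrow> int" where v: "v = (\<Sum>i\<in>UNIV. of_int (z i) *\<^sub>R (real (d i) *\<^sub>R a i)) +
      real k *\<^sub>R (\<Sum>i\<in>UNIV. of_int (w i) *\<^sub>R a i)"
    unfolding diag_lattice_def by (blast elim: int_spanE)
  have "\<exists>u. z i * int (d i) + int k * w i = u * int (gcd (d i) k)" for i
    by (metis dvd_add dvd_def dvd_mult dvd_mult2 gcd_dvd1 gcd_dvd2 int_dvd_int_iff mult.commute)
  then obtain u where u: "\<And>i. z i * int (d i) + int k * w i = u i * int (gcd (d i) k)"
    by metis
  have "v = (\<Sum>i\<in>UNIV. of_int (z i * int (d i) + int k * w i) *\<^sub>R a i)"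
    unfolding v by (simp add: scaleR_sum_right sum.distrib scaleR_add_left)
  also have "\<dots> = (\<Sum>i\<in>UNIV. of_int (u i) *\<^sub>R (real (gcd (d i) k) *\<^sub>R a i))"
    by (simp add: u)
  finally show "v \<in> diag_lattice a (\<lambda>i. gcd (d i) k)"
    unfolding diag_lattice_def by (rule int_spanI)
next
  fix v assume "v \<in> diag_lattice a (\<lambda>i. gcd (d i) k)"
  then obtain u :: "'n \<Rightarrow> int" where v: "v = (\<Sum>i\<in>UNIV. of_int (u i) *\<^sub>R (real (gcd (d i) k) *\<^sub>R a i))"
    unfolding diag_lattice_def by (rule int_spanE)
  have "\<exists>z w. int (gcd (d i) k) = z * int (d i) + int k * w" for i
    by (metis bezout_int gcd_int_int_eq mult.commute)
  then obtain z w where zw: "\<And>i. int (gcd (d i) k) = z i * int (d i) + int k * w i"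
    by metis
  have "v = (\<Sum>i\<in>UNIV. of_int (u i * int (gcd (d i) k)) *\<^sub>R a i)"
    unfolding v by simp
  also have "\<dots> = (\<Sum>i\<in>UNIV. of_int (u i * z i) *\<^sub>R (real (d i) *\<^sub>R a i)) +
      real k *\<^sub>R (\<Sum>i\<in>UNIV. of_int (u i * w i) *\<^sub>R a i)"
    by (simp add: zw scaleR_sum_right sum.distrib scaleR_add_left algebra_simps)
  finally show "v \<in> {x + real k *\<^sub>R y | x y. x \<in> diag_lattice a d \<and> y \<in> int_span a}"
    using int_spanI[OF refl, of "\<lambda>i. u i * z i" "\<lambda>i. real (d i) *\<^sub>R a i"]
      int_spanI[OF refl, of "\<lambda>i. u i * w i" a]
    unfolding diag_lattice_def by blast
qed

text \<open>Induction along the rank: once all earlier entries agree, the gcd products for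
  \<open>k = d j\<close> and \<open>k = e j\<close> force \<open>d j\<close> and \<open>e j\<close>
  to divide each other.\<close>

lemma divisor_chain_eqI:
  fixes d e :: "'n::finite \<Rightarrow> nat" and r :: "'n \<Rightarrow> nat"
  assumes r: "inj r"
    and d: "\<And>i. d i > 0" "\<And>i j. r i \<le> r j \<Longrightarrow> d i dvd d j"
    and e: "\<And>i. e i > 0" "\<And>i j. r i \<le> r j \<Longrightarrow> e i dvd e j"
    and gcd_eq: "\<And>k. k > 0 \<Longrightarrow> (\<Prod>i\<in>UNIV. gcd (d i) k) = (\<Prod>i\<in>UNIV. gcd (e i) k)"
  shows "d = e"
proof
  fix j
  show "d j = e j"
  proof (induction "r j" arbitrary: j rule: less_induct)
    case less
    \<comment> \<open>A generic pair lets \<open>d\<close> and \<open>e\<close> trade places.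
      Factors of smaller rank agree, and from rank \<open>r j\<close> on the gcd of
      \<open>f i\<close> with \<open>f j\<close> is \<open>f j\<close>, the largest possible value.
      A failure of divisibility at \<open>j\<close> would make the product for \<open>g\<close>
      strictly smaller.\<close>
    have dvd: "f j dvd g j"
      if f: "\<And>i. f i > 0" "\<And>i j. r i \<le> r j \<Longrightarrow> f i dvd f j"
        and fg: "(\<Prod>i\<in>UNIV. gcd (f i) (f j)) = (\<Prod>i\<in>UNIV. gcd (g i) (f j))"
          "\<And>i. r i < r j \<Longrightarrow> f i = g i" for f g :: "'n \<Rightarrow> nat"
    proof (rule ccontr)
      assume "\<not> f j dvd g j"
      then have "gcd (g j) (f j) < f j"
        using f(1)[of j] by (metis gcd_dvd1 gcd_dvd2 dvd_imp_le le_neq_implies_less)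
      moreover have "gcd (g i) (f j) \<le> gcd (f i) (f j)" for i
      proof (cases "r i < r j")
        case False
        then have "f j dvd f i"
          using f(2) by simp
        then show ?thesis
          using f(1)[of j] by (simp add: gcd_nat.absorb2 gcd_le2_nat)
      qed (simp add: fg)
      ultimately have "(\<Prod>i\<in>UNIV. gcd (g i) (f j)) < (\<Prod>i\<in>UNIV. gcd (f i) (f j))"
        using f(1) by (intro prod_mono_strict[of j]) auto
      then show False
        using fg(1) by simp
    qed
    have "d j dvd e j"
      by (rule dvd[OF d gcd_eq[OF d(1)] less])
    moreover have "e j dvd d j"
      by (rule dvd[OF e gcd_eq[OF e(1), symmetric] less[symmetric]])
    ultimately show ?case
      by (rule dvd_antisym)
  qed
qed

text \<open>Moving \<open>a\<close> by the equivalence \<open>\<sigma>\<close> yields one sublattice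
  written in two bases of \<open>L\<close>. Adding the \<open>k\<close>-fold multiples of
  \<open>L\<close> to it keeps the two descriptions equal, and computing the index from each yields
  the gcd products.\<close>

lemma equivalent_diag_lattices_imp_eq:
  fixes r :: "'n::finite \<Rightarrow> nat"
  assumes a: "lattice_basis a L" and b: "lattice_basis b L"
    and r: "inj r"
    and d: "\<And>i. d i > 0" "\<And>i j. r i \<le> r j \<Longrightarrow> d i dvd d j"
    and e: "\<And>i. e i > 0" "\<And>i j. r i \<le> r j \<Longrightarrow> e i dvd e j"
    and eq: "equivalent_sublattices L (diag_lattice a d) (diag_lattice b e)"
  shows "d = e"
proof (rule divisor_chain_eqI[OF r d e])
  fix k :: nat assume "k > 0"
  obtain \<sigma> where \<sigma>: "linear \<sigma>" "\<sigma> ` L = L" "\<sigma> ` diag_lattice a d = diag_lattice b e"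
    using eq unfolding equivalent_sublattices_def by blast
  have span: "int_span (\<sigma> \<circ> a) = L" "int_span b = L"
    using image_int_span[OF \<sigma>(1), of a] \<sigma>(2) a b by (metis lattice_basis_int_span)+
  then have \<sigma>a: "lattice_basis (\<sigma> \<circ> a) L"
    using a lattice_basis_iff is_lattice_def by metis
  have "diag_lattice (\<sigma> \<circ> a) d = diag_lattice b e"
    using \<sigma> image_diag_lattice by metis
  then have "diag_lattice (\<sigma> \<circ> a) (\<lambda>i. gcd (d i) k) = diag_lattice b (\<lambda>i. gcd (e i) k)"
    unfolding diag_lattice_plus_multiples[symmetric] span by simp
  moreover have "lattice_index (diag_lattice (\<sigma> \<circ> a) (\<lambda>i. gcd (d i) k)) L = (\<Prod>i\<in>UNIV. gcd (d i) k)"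
    using diag_lattice_in_sublattices_of_index[OF \<sigma>a, of "\<lambda>i. gcd (d i) k"] \<open>k > 0\<close>
    by (simp add: sublattices_of_index_def)
  moreover have "lattice_index (diag_lattice b (\<lambda>i. gcd (e i) k)) L = (\<Prod>i\<in>UNIV. gcd (e i) k)"
    using diag_lattice_in_sublattices_of_index[OF b, of "\<lambda>i. gcd (e i) k"] \<open>k > 0\<close>
    by (simp add: sublattices_of_index_def)
  ultimately show "(\<Prod>i\<in>UNIV. gcd (d i) k) = (\<Prod>i\<in>UNIV. gcd (e i) k)"
    by simp
qed

section \<open>Counting divisor chains\<close>

text \<open>These are partitions with parts indexed by \<open>'n\<close> and zeros allowed; they
  arise as the valuations of a divisor chain at one prime.\<close>

definition chains_of_sum :: "('n::finite \<Rightarrow> nat) \<Rightarrow> nat \<Rightarrow> ('n \<Rightarrow> nat) set" where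
  "chains_of_sum r k = {f. (\<forall>i j. r i \<le> r j \<longrightarrow> f i \<le> f j) \<and> (\<Sum>i\<in>UNIV. f i) = k}"

definition divisor_chains :: "('n::finite \<Rightarrow> nat) \<Rightarrow> nat \<Rightarrow> ('n \<Rightarrow> nat) set" where
  "divisor_chains r m = {d. (\<forall>i j. r i \<le> r j \<longrightarrow> d i dvd d j) \<and> (\<Prod>i\<in>UNIV. d i) = m}"

lemma card_chains_of_sum:
  fixes r :: "'n::finite \<Rightarrow> nat"
  assumes r: "bij_betw r UNIV {..<CARD('n)}"
  shows "card (chains_of_sum r k) = num_partitions CARD('n) k"
proof -
  define h where "h = inv r"
  \<comment> \<open>Chains increase with the rank while partitions are listed in decreasing order,
    so \<open>zs\<close> runs through the indices by falling rank.\<close>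
  define zs where "zs = map h (rev [0..<CARD('n)])"
  have rh: "r (h k) = k" if "k < CARD('n)" for k
    using r that unfolding h_def by (intro f_inv_into_f) (auto simp: bij_betw_def)
  have hr: "h (r i) = i" for i
    using r unfolding h_def by (intro inv_f_f) (auto simp: bij_betw_def)
  have r_less: "r i < CARD('n)" for i
    using r by (auto simp: bij_betw_def)
  have inj_h: "inj_on h {0..<CARD('n)}"
    by (rule inj_on_inverseI[of _ r]) (simp add: rh)
  have range_h: "h ` {0..<CARD('n)} = UNIV"
    using hr r_less by (metis atLeast0LessThan lessThan_iff rev_image_eqI surjI UNIV_eq_I)
  have length_zs: "length zs = CARD('n)"
    by (simp add: zs_def)
  have distinct_zs: "distinct zs"
    using inj_h by (simp add: zs_def distinct_map)
  have set_zs: "set zs = UNIV"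
    using range_h by (simp add: zs_def)
  have sorted_zs: "sorted_wrt (\<lambda>i j. r j \<le> r i) zs"
  proof -
    have "sorted_wrt (\<lambda>x y. r (h y) \<le> r (h x)) (rev [0..<CARD('n)])"
      unfolding sorted_wrt_rev
      by (rule sorted_wrt_mono_rel[OF _ sorted_wrt_upt]) (auto simp: rh)
    then show ?thesis
      by (simp add: zs_def sorted_wrt_map)
  qed
  have "bij_betw (\<lambda>f. map f zs) (chains_of_sum r k)
      {xs. length xs = CARD('n) \<and> sorted_wrt (\<ge>) xs \<and> sum_list xs = k}"
  proof (rule bij_betwI')
    fix f g :: "'n \<Rightarrow> nat"
    show "(map f zs = map g zs) = (f = g)"
      using set_zs by (auto simp: fun_eq_iff)
  next
    fix f assume f: "f \<in> chains_of_sum r k"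
    have "sorted_wrt (\<ge>) (map f zs)"
      using f sorted_zs unfolding sorted_wrt_map chains_of_sum_def
      by (auto elim!: sorted_wrt_mono_rel[rotated])
    moreover have "sum_list (map f zs) = k"
      using f distinct_zs set_zs by (simp add: sum_list_distinct_conv_sum_set chains_of_sum_def)
    ultimately show "map f zs \<in> {xs. length xs = CARD('n) \<and> sorted_wrt (\<ge>) xs \<and> sum_list xs = k}"
      by (simp add: length_zs)
  next
    fix xs assume "xs \<in> {xs :: nat list. length xs = CARD('n) \<and> sorted_wrt (\<ge>) xs \<and> sum_list xs = k}"
    then have xs: "length xs = CARD('n)" "sorted_wrt (\<ge>) xs" "sum_list xs = k"
      by auto
    \<comment> \<open>The index \<open>i\<close> stands at position
      \<open>CARD('n) - 1 - r i\<close> of \<open>zs\<close>.\<close>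
    define f where "f = (\<lambda>i. xs ! (CARD('n) - 1 - r i))"
    have map_f: "map f zs = xs"
      by (rule nth_equalityI) (auto simp: zs_def f_def xs(1) rev_nth rh)
    have "f i \<le> f j" if "r i \<le> r j" for i j
    proof (cases "r i = r j")
      case False
      then have "CARD('n) - 1 - r j < CARD('n) - 1 - r i"
        using that r_less[of j] by linarith
      then show ?thesis
        using sorted_wrt_nth_less[OF xs(2)] r_less[of i] unfolding f_def xs(1) by simp
    qed (simp add: f_def)
    moreover have "(\<Sum>i\<in>UNIV. f i) = k"
      using sum_list_distinct_conv_sum_set[OF distinct_zs, of f] by (simp add: map_f xs(3) set_zs)
    ultimately show "\<exists>f\<in>chains_of_sum r k. xs = map f zs"
      using map_f by (auto simp: chains_of_sum_def)
  qed
  then show ?thesis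
    unfolding num_partitions_def by (rule bij_betw_same_card)
qed

text \<open>Taking valuations turns divisibility into \<open>\<le>\<close> and products into sums,
  independently at each prime. A divisor chain is therefore a free choice of one exponent chain for
  each \<open>i\<close> in \<open>I\<close>.\<close>

lemma card_divisor_chains:
  fixes r :: "'n::finite \<Rightarrow> nat" and p \<alpha> :: "nat \<Rightarrow> nat"
  assumes p: "\<And>i. i \<in> I \<Longrightarrow> prime (p i)" and inj: "inj_on p I" and fin: "finite I"
  shows "card (divisor_chains r (\<Prod>i\<in>I. p i ^ \<alpha> i)) = (\<Prod>i\<in>I. card (chains_of_sum r (\<alpha> i)))"
proof -
  let ?m = "\<Prod>i\<in>I. p i ^ \<alpha> i"
  have mult: "multiplicity (p i) (\<Prod>i\<in>I. p i ^ e i) = e i" if "i \<in> I" for e i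
  proof -
    \<comment> \<open>Injectivity of \<open>p\<close> allows the product to be indexed by the primes
      themselves, where the multiplicity can be read off.\<close>
    have reindex: "(\<Prod>i\<in>I. p i ^ e i) = (\<Prod>q\<in>p ` I. q ^ e (inv_into I p q))"
      using inj by (simp add: prod.reindex)
    show ?thesis
      unfolding reindex
      by (subst multiplicity_prod_prime_powers) (use that p inj fin in auto)
  qed
  have m_pos: "?m > 0"
    using p by (intro prod_pos) (simp add: prime_gt_0_nat)
  have decomp: "d = (\<Prod>i\<in>I. p i ^ multiplicity (p i) d)" if "d dvd ?m" for d
  proof (rule multiplicity_eq_nat)
    show "d > 0"
      using m_pos that by (rule dvd_pos_nat)
    show "(\<Prod>i\<in>I. p i ^ multiplicity (p i) d) > 0"
      using p by (intro prod_pos) (simp add: prime_gt_0_nat)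
    fix q :: nat assume q: "prime q"
    show "multiplicity q d = multiplicity q (\<Prod>i\<in>I. p i ^ multiplicity (p i) d)"
    proof (cases "q \<in> p ` I")
      case True
      then show ?thesis
        using mult by auto
    next
      case False
      \<comment> \<open>A prime outside the image of \<open>p\<close> divides no such product; this
        covers both \<open>?m\<close>, hence its divisor \<open>d\<close>, and the rebuilt
        number.\<close>
      have "\<not> q dvd (\<Prod>i\<in>I. p i ^ e i)" for e
      proof
        assume "q dvd (\<Prod>i\<in>I. p i ^ e i)"
        then obtain i where "i \<in> I" "q dvd p i"
          using q fin by (auto simp: prime_dvd_prod_iff dest: prime_dvd_power)
        then show False
          using p q False by (metis imageI primes_dvd_imp_eq)
      qed
      then have "multiplicity q d = 0" "multiplicity q (\<Prod>i\<in>I. p i ^ multiplicity (p i) d) = 0"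
        using that by (auto intro!: not_dvd_imp_multiplicity_0 dest: dvd_trans)
      then show ?thesis
        by simp
    qed
  qed
  \<comment> \<open>The restriction to \<open>I\<close> fixes the values outside \<open>I\<close>,
    as the extensional product on the right demands.\<close>
  have "bij_betw (\<lambda>d. \<lambda>i\<in>I. \<lambda>x. multiplicity (p i) (d x)) (divisor_chains r ?m)
      (\<Pi>\<^sub>E i\<in>I. chains_of_sum r (\<alpha> i))"
  proof (rule bij_betw_byWitness[where f' = "\<lambda>F x. \<Prod>i\<in>I. p i ^ F i x"])
    have dvd_m: "d x dvd ?m" if "d \<in> divisor_chains r ?m" for d x
      using that dvd_prodI[of UNIV x d] by (simp add: divisor_chains_def)
    show "\<forall>d\<in>divisor_chains r ?m.
        (\<lambda>x. \<Prod>i\<in>I. p i ^ (\<lambda>i\<in>I. \<lambda>x. multiplicity (p i) (d x)) i x) = d"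
    proof
      fix d assume "d \<in> divisor_chains r ?m"
      then show "(\<lambda>x. \<Prod>i\<in>I. p i ^ (\<lambda>i\<in>I. \<lambda>x. multiplicity (p i) (d x)) i x) = d"
        using decomp[OF dvd_m, symmetric] by auto
    qed
    show "\<forall>F\<in>\<Pi>\<^sub>E i\<in>I. chains_of_sum r (\<alpha> i).
        (\<lambda>i\<in>I. \<lambda>x. multiplicity (p i) (\<Prod>i\<in>I. p i ^ F i x)) = F"
    proof
      fix F assume F: "F \<in> (\<Pi>\<^sub>E i\<in>I. chains_of_sum r (\<alpha> i))"
      have "(\<lambda>i\<in>I. \<lambda>x. multiplicity (p i) (\<Prod>i\<in>I. p i ^ F i x)) = restrict F I"
        by (rule restrict_ext) (simp add: mult)
      then show "(\<lambda>i\<in>I. \<lambda>x. multiplicity (p i) (\<Prod>i\<in>I. p i ^ F i x)) = F"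
        using PiE_restrict[OF F] by simp
    qed
    show "(\<lambda>d. \<lambda>i\<in>I. \<lambda>x. multiplicity (p i) (d x)) ` divisor_chains r ?m
        \<subseteq> (\<Pi>\<^sub>E i\<in>I. chains_of_sum r (\<alpha> i))"
    proof (intro image_subsetI restrict_PiE_iff[THEN iffD2] ballI)
      fix d i assume d: "d \<in> divisor_chains r ?m" and i: "i \<in> I"
      have pos: "d x > 0" for x
        using m_pos dvd_m[OF d] by (rule dvd_pos_nat)
      have "(\<Sum>x\<in>UNIV. multiplicity (p i) (d x)) = multiplicity (p i) (\<Prod>x\<in>UNIV. d x)"
        using p[OF i] pos
        by (intro prime_elem_multiplicity_prod_distrib[symmetric])
          (auto simp: image_iff intro: less_imp_neq)
      also have "\<dots> = \<alpha> i"
        using d mult[OF i] by (simp add: divisor_chains_def)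
      finally show "(\<lambda>x. multiplicity (p i) (d x)) \<in> chains_of_sum r (\<alpha> i)"
        using d pos
        by (auto simp: divisor_chains_def chains_of_sum_def simp flip: neq0_conv
            intro!: dvd_imp_multiplicity_le)
    qed
    show "(\<lambda>F x. \<Prod>i\<in>I. p i ^ F i x) ` (\<Pi>\<^sub>E i\<in>I. chains_of_sum r (\<alpha> i)) \<subseteq> divisor_chains r ?m"
    proof (rule image_subsetI)
      fix F assume "F \<in> (\<Pi>\<^sub>E i\<in>I. chains_of_sum r (\<alpha> i))"
      then have F: "F i \<in> chains_of_sum r (\<alpha> i)" if "i \<in> I" for i
        using that by auto
      have "(\<Prod>x\<in>UNIV. \<Prod>i\<in>I. p i ^ F i x) = (\<Prod>i\<in>I. \<Prod>x\<in>UNIV. p i ^ F i x)"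
        by (rule prod.swap)
      also have "\<dots> = ?m"
        using F by (intro prod.cong) (auto simp: chains_of_sum_def simp flip: power_sum)
      finally show "(\<lambda>x. \<Prod>i\<in>I. p i ^ F i x) \<in> divisor_chains r ?m"
        using F by (auto simp: divisor_chains_def chains_of_sum_def intro!: prod_dvd_prod le_imp_power_dvd)
    qed
  qed
  from bij_betw_same_card[OF this] show ?thesis
    using fin by (simp add: card_PiE)
qed

section \<open>Equivalence classes of sublattices\<close>

text \<open>Diagonal sublattices in one fixed basis represent the classes: invariance of the chain
  makes them pairwise inequivalent, and stacked bases show that every class is met.\<close>

lemma num_sublattice_classes_eq_card_divisor_chains:
  fixes L :: "(real ^ 'n::finite) set" and r :: "'n \<Rightarrow> nat"
  assumes L: "is_lattice L" and r: "bij_betw r UNIV {..<CARD('n)}" and m: "m > 0"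
  shows "num_sublattice_classes L m = card (divisor_chains r m)"
proof -
  obtain a where a: "lattice_basis a L"
    using L unfolding is_lattice_def by blast
  let ?S = "sublattices_of_index L m"
  define R where "R = {(L1, L2). L1 \<in> ?S \<and> L2 \<in> ?S \<and> equivalent_sublattices L L1 L2}"
  have equiv: "equiv ?S R"
    unfolding R_def by (rule equiv_equivalent_sublattices[OF L])
  have chain_pos: "d i > 0" if "d \<in> divisor_chains r m" for d i
    using that m by (auto simp: divisor_chains_def intro: gr0I)
  have in_S: "diag_lattice a d \<in> ?S" if "d \<in> divisor_chains r m" for d
    using diag_lattice_in_sublattices_of_index[OF a, of d] chain_pos[OF that] that
    by (simp add: divisor_chains_def)
  have "bij_betw (\<lambda>d. R `` {diag_lattice a d}) (divisor_chains r m) (?S // R)"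
  proof (rule bij_betwI')
    fix d e assume d: "d \<in> divisor_chains r m" and e: "e \<in> divisor_chains r m"
    show "(R `` {diag_lattice a d} = R `` {diag_lattice a e}) = (d = e)"
    proof
      assume "R `` {diag_lattice a d} = R `` {diag_lattice a e}"
      then have "equivalent_sublattices L (diag_lattice a d) (diag_lattice a e)"
        using eq_equiv_class[OF _ equiv in_S[OF e]] by (simp add: R_def)
      then show "d = e"
        using d e chain_pos r
        by (intro equivalent_diag_lattices_imp_eq[OF a a, of r d e])
          (auto simp: divisor_chains_def bij_betw_def)
    qed simp
  next
    fix d assume "d \<in> divisor_chains r m"
    then show "R `` {diag_lattice a d} \<in> ?S // R"
      by (intro quotientI in_S)
  next
    fix X assume "X \<in> ?S // R"
    then obtain L' where L': "L' \<in> ?S" "X = R `` {L'}"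
      by (rule quotientE)
    obtain b d where b: "lattice_basis b L" and L'_eq: "L' = diag_lattice b d"
      and "\<And>i j. r i \<le> r j \<Longrightarrow> d i dvd d j" "(\<Prod>i\<in>UNIV. d i) = m"
      using stacked_bases[OF L L'(1) r] by blast
    then have d: "d \<in> divisor_chains r m"
      by (simp add: divisor_chains_def)
    \<comment> \<open>The basis \<open>b\<close> depends on \<open>L'\<close>; passing to the fixed
      basis \<open>a\<close> stays within the class.\<close>
    have "(L', diag_lattice a d) \<in> R"
      using equivalent_diag_lattices[OF b a, of d] L'(1) in_S[OF d] by (simp add: R_def L'_eq)
    then have "X = R `` {diag_lattice a d}"
      using L'(2) equiv_class_eq[OF equiv] by simp
    then show "\<exists>d\<in>divisor_chains r m. X = R `` {diag_lattice a d}"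
      using d by blast
  qed
  from bij_betw_same_card[OF this] show ?thesis
    unfolding num_sublattice_classes_def R_def by simp
qed

theorem theoremZ:
  fixes L :: "(real ^ 'n::finite) set"
    and m l :: nat
    and p \<alpha> :: "nat \<Rightarrow> nat"
  assumes "is_lattice L"
    and "\<And>i. i \<in> {1..l} \<Longrightarrow> prime (p i)"
    and "inj_on p {1..l}"
    and "\<And>i. i \<in> {1..l} \<Longrightarrow> \<alpha> i > 0"
    and "m = (\<Prod>i=1..l. p i ^ \<alpha> i)"
  shows "num_sublattice_classes L m = (\<Prod>i=1..l. num_partitions CARD('n) (\<alpha> i))"
proof -
  have "m > 0"
    unfolding assms(5) using assms(2) by (intro prod_pos) (simp add: prime_gt_0_nat)
  \<comment> \<open>An arbitrary enumeration of the index type supplies the order along which chains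
    are formed.\<close>
  obtain r :: "'n \<Rightarrow> nat" where r: "bij_betw r UNIV {..<CARD('n)}"
    using ex_bij_betw_finite_nat[OF finite, of "UNIV :: 'n set"] by (auto simp: atLeast0LessThan)
  have "num_sublattice_classes L m = card (divisor_chains r m)"
    using assms(1) r \<open>m > 0\<close> by (rule num_sublattice_classes_eq_card_divisor_chains)
  also have "\<dots> = (\<Prod>i=1..l. card (chains_of_sum r (\<alpha> i)))"
    unfolding assms(5) using assms(2,3) by (intro card_divisor_chains) auto
  also have "\<dots> = (\<Prod>i=1..l. num_partitions CARD('n) (\<alpha> i))"
    by (simp add: card_chains_of_sum[OF r])
  finally show ?thesis .
qed

end
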